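(* Let $\mathbf{I}\mathbb{N}_{\infty}$ be the monoid of all partial cofinite isometries of $\mathbb{N}$ and let $\mathfrak{C}_{\mathbf{mg}}$ be its least group congruence. For elements $\alpha,\beta\in\mathbf{I}\mathbb{N}_{\infty}$ the following conditions are equivalent: (i) $\alpha\,\mathfrak{C}_{\mathbf{mg}}\,\beta$; (ii) there exists a positive integer $i\in\operatorname{dom}\alpha\cap\operatorname{dom}\beta$ such that $(i)\alpha=(i)\beta$; (iii) $(i)\alpha=(i)\beta$ for all $i\in\operatorname{dom}\alpha\cap\operatorname{dom}\beta$.
   Context: $\mathbb{N}=\{1,2,3,\ldots\}$ with the metric $d(n,m)=|n-m|$. $\mathbf{I}\mathbb{N}_{\infty}$ is the inverse monoid of all partial maps $\alpha:\mathbb{N}\rightharpoonup\mathbb{N}$ such that $\mathbb{N}\setminus\operatorname{dom}\alpha$ and $\mathbb{N}\setminus\operatorname{ran}\alpha$ are finite and $|(x)\alpha-(y)\alpha|=|x-y|$ for all $x,y\in\operatorname{dom}\alpha$, with composition written left to right: $(x)(\alpha\beta)=((x)\alpha)\beta$, $\operatorname{dom}(\alpha\beta)=\{x\in\operatorname{dom}\alpha:(x)\alpha\in\operatorname{dom}\beta\}$. The least group congruence $\mathfrak{C}_{\mathbf{mg}}$ on an inverse semigroup $S$ is defined by: $s\,\mathfrak{C}_{\mathbf{mg}}\,t$ if and only if there exists an idempotent $e\in S$ such that $es=et$. *)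

theory Defs
  imports "HOL-Algebra.Group"
begin

definition pos_nats :: "nat set"
  where "pos_nats = {n. 1 \<le> n}"

definition partial_cofinite_isometry :: "(nat \<rightharpoonup> nat) \<Rightarrow> bool"
  where "partial_cofinite_isometry \<alpha> \<longleftrightarrow>
    dom \<alpha> \<subseteq> pos_nats \<and> ran \<alpha> \<subseteq> pos_nats \<and>
    finite (pos_nats - dom \<alpha>) \<and> finite (pos_nats - ran \<alpha>) \<and>
    (\<forall>x\<in>dom \<alpha>. \<forall>y\<in>dom \<alpha>.
      \<bar>int (the (\<alpha> x)) - int (the (\<alpha> y))\<bar> = \<bar>int x - int y\<bar>)"

(* Maps act on the right, so the product of \<alpha> and \<beta> applies \<alpha> first. *)
definition IN_inf :: "(nat \<rightharpoonup> nat) monoid"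
  where "IN_inf =
    \<lparr>carrier = {\<alpha>. partial_cofinite_isometry \<alpha>},
     mult = (\<lambda>\<alpha> \<beta>. \<beta> \<circ>\<^sub>m \<alpha>),
     one = (\<lambda>n. if n \<in> pos_nats then Some n else None)\<rparr>"

(* On an inverse semigroup S this relation is the least group congruence. *)
definition least_group_congruence :: "('a, 'b) monoid_scheme \<Rightarrow> ('a \<times> 'a) set"
  where "least_group_congruence S =
    {(s, t). s \<in> carrier S \<and> t \<in> carrier S \<and>
      (\<exists>e\<in>carrier S. e \<otimes>\<^bsub>S\<^esub> e = e \<and> e \<otimes>\<^bsub>S\<^esub> s = e \<otimes>\<^bsub>S\<^esub> t)}"

lemma partial_cofinite_isometry_inj:
  assumes "partial_cofinite_isometry \<alpha>" "\<alpha> x = Some z" "\<alpha> y = Some z"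
  shows "x = y"
proof -
  have "x \<in> dom \<alpha>" "y \<in> dom \<alpha>"
    using assms by auto
  then have "\<bar>int (the (\<alpha> x)) - int (the (\<alpha> y))\<bar> = \<bar>int x - int y\<bar>"
    using assms(1) unfolding partial_cofinite_isometry_def by blast
  then show ?thesis
    using assms by simp
qed

lemma partial_cofinite_isometry_comp:
  assumes a: "partial_cofinite_isometry \<alpha>" and b: "partial_cofinite_isometry \<beta>"
  shows "partial_cofinite_isometry (\<beta> \<circ>\<^sub>m \<alpha>)"
proof -
  have "pos_nats - dom (\<beta> \<circ>\<^sub>m \<alpha>) \<subseteq>
      (pos_nats - dom \<alpha>) \<union> {x. \<exists>z. \<alpha> x = Some z \<and> z \<in> pos_nats - dom \<beta>}"
    using a unfolding partial_cofinite_isometry_def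
    by (auto simp: map_comp_def ran_def split: option.splits)
  moreover have "finite {x. \<exists>z. \<alpha> x = Some z \<and> z \<in> pos_nats - dom \<beta>}"
  proof (rule finite_imageD)
    show "finite ((\<lambda>x. the (\<alpha> x)) ` {x. \<exists>z. \<alpha> x = Some z \<and> z \<in> pos_nats - dom \<beta>})"
      by (rule finite_subset[of _ "pos_nats - dom \<beta>"])
        (use b in \<open>auto simp: partial_cofinite_isometry_def\<close>)
    show "inj_on (\<lambda>x. the (\<alpha> x)) {x. \<exists>z. \<alpha> x = Some z \<and> z \<in> pos_nats - dom \<beta>}"
      by (rule inj_onI) (use partial_cofinite_isometry_inj[OF a] in force)
  qed
  ultimately have d: "finite (pos_nats - dom (\<beta> \<circ>\<^sub>m \<alpha>))"
    using a unfolding partial_cofinite_isometry_def by (meson finite_UnI finite_subset)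
  have "pos_nats - ran (\<beta> \<circ>\<^sub>m \<alpha>) \<subseteq>
      (pos_nats - ran \<beta>) \<union> (\<lambda>z. the (\<beta> z)) ` (pos_nats - ran \<alpha>)"
  proof
    fix w assume w: "w \<in> pos_nats - ran (\<beta> \<circ>\<^sub>m \<alpha>)"
    show "w \<in> (pos_nats - ran \<beta>) \<union> (\<lambda>z. the (\<beta> z)) ` (pos_nats - ran \<alpha>)"
    proof (cases "w \<in> ran \<beta>")
      case True
      then obtain z where z: "\<beta> z = Some w" by (auto simp: ran_def)
      have "z \<notin> ran \<alpha>"
        using w z by (auto simp: ran_def map_comp_def split: option.splits)
      moreover have "z \<in> pos_nats"
        using b z unfolding partial_cofinite_isometry_def by blast
      ultimately show ?thesis using z by force
    qed (use w in auto)
  qed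
  then have r: "finite (pos_nats - ran (\<beta> \<circ>\<^sub>m \<alpha>))"
    using a b unfolding partial_cofinite_isometry_def
    by (meson finite_UnI finite_imageI finite_subset)
  have i: "\<bar>int (the ((\<beta> \<circ>\<^sub>m \<alpha>) x)) - int (the ((\<beta> \<circ>\<^sub>m \<alpha>) y))\<bar> = \<bar>int x - int y\<bar>"
    if xy: "x \<in> dom (\<beta> \<circ>\<^sub>m \<alpha>)" "y \<in> dom (\<beta> \<circ>\<^sub>m \<alpha>)" for x y
  proof -
    obtain u v u' v' where h: "\<alpha> x = Some u" "\<beta> u = Some u'" "\<alpha> y = Some v" "\<beta> v = Some v'"
      using xy by (auto simp: map_comp_def split: option.splits)
    have "\<bar>int (the (\<alpha> x)) - int (the (\<alpha> y))\<bar> = \<bar>int x - int y\<bar>"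
      using a h unfolding partial_cofinite_isometry_def by blast
    moreover have "\<bar>int (the (\<beta> u)) - int (the (\<beta> v))\<bar> = \<bar>int u - int v\<bar>"
      using b h unfolding partial_cofinite_isometry_def by blast
    ultimately show ?thesis using h by simp
  qed
  have "dom (\<beta> \<circ>\<^sub>m \<alpha>) \<subseteq> dom \<alpha>" "ran (\<beta> \<circ>\<^sub>m \<alpha>) \<subseteq> ran \<beta>"
    by (auto simp: ran_def map_comp_def split: option.splits)
  then have "dom (\<beta> \<circ>\<^sub>m \<alpha>) \<subseteq> pos_nats" "ran (\<beta> \<circ>\<^sub>m \<alpha>) \<subseteq> pos_nats"
    using a b unfolding partial_cofinite_isometry_def by (meson subset_trans)+
  then show ?thesis
    unfolding partial_cofinite_isometry_def by (intro conjI ballI d r i)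
qed

lemma IN_inf_monoid: "monoid IN_inf"
proof (rule monoidI)
  have dom1: "dom \<one>\<^bsub>IN_inf\<^esub> = pos_nats" and ran1: "ran \<one>\<^bsub>IN_inf\<^esub> = pos_nats"
    by (auto simp: IN_inf_def dom_def ran_def)
  then show "\<one>\<^bsub>IN_inf\<^esub> \<in> carrier IN_inf"
    by (auto simp: IN_inf_def partial_cofinite_isometry_def)
next
  fix x y assume "x \<in> carrier IN_inf" "y \<in> carrier IN_inf"
  then show "x \<otimes>\<^bsub>IN_inf\<^esub> y \<in> carrier IN_inf"
    by (simp add: IN_inf_def partial_cofinite_isometry_comp)
next
  fix x y z
  show "x \<otimes>\<^bsub>IN_inf\<^esub> y \<otimes>\<^bsub>IN_inf\<^esub> z = x \<otimes>\<^bsub>IN_inf\<^esub> (y \<otimes>\<^bsub>IN_inf\<^esub> z)"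
    by (auto simp: IN_inf_def map_comp_def fun_eq_iff split: option.splits)
next
  fix x assume x: "x \<in> carrier IN_inf"
  then have "\<And>n. n \<notin> pos_nats \<Longrightarrow> x n = None" "\<And>n m. x n = Some m \<Longrightarrow> m \<in> pos_nats"
    unfolding IN_inf_def partial_cofinite_isometry_def by (auto intro: ranI)
  then show "\<one>\<^bsub>IN_inf\<^esub> \<otimes>\<^bsub>IN_inf\<^esub> x = x" "x \<otimes>\<^bsub>IN_inf\<^esub> \<one>\<^bsub>IN_inf\<^esub> = x"
    by (auto simp: IN_inf_def map_comp_def fun_eq_iff split: option.splits)
qed

end

theory Submission
  imports Defs
begin

text \<open>
  Every cofinite partial isometry of \<open>\<nat>\<close> is a restriction of a translation. The only isometries of
  the integers are translations and reflections, and a reflection sends all large numbers below \<open>1\<close>,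
  while a cofinite domain contains arbitrarily large numbers (\<open>isometry_shift\<close>). So a single
  common value of \<open>\<alpha>\<close> and \<open>\<beta>\<close> forces equal translation lengths, hence equality on all common
  arguments. Cofinite domains always meet (\<open>cofinite_doms_meet\<close>), so the ``for all'' condition
  is never vacuous and implies the ``exists'' condition.

  The idempotents are the partial identities with cofinite domain, so multiplying by one on the
  left restricts the domain: \<open>\<alpha>\<close> and \<open>\<beta>\<close> are congruent iff their restrictions to some cofinite set
  coincide. Any point common to this set and to both domains gives the ``exists'' condition;
  conversely, the identity on \<open>dom \<alpha> \<inter> dom \<beta>\<close> witnesses the congruence once \<open>\<alpha>\<close> and \<open>\<beta>\<close> agree
  there.
\<close>

lemma isometry_cofinite_dom:
  assumes "partial_cofinite_isometry \<alpha>"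
  shows "finite (- dom \<alpha>)"
proof -
  have "- dom \<alpha> \<subseteq> insert 0 (pos_nats - dom \<alpha>)"
    by (auto simp: pos_nats_def)
  then show ?thesis
    using assms unfolding partial_cofinite_isometry_def
    by (meson finite_insert finite_subset)
qed

text \<open>
  Both displacements are compared with that of one point \<open>n\<close> of the domain, taken so large that
  the reflected solution \<open>\<alpha> x - (n - x)\<close> of the distance equation is negative, and likewise for \<open>y\<close>.
\<close>
lemma isometry_shift:
  assumes \<alpha>: "partial_cofinite_isometry \<alpha>" and x: "\<alpha> x = Some u" and y: "\<alpha> y = Some v"
  shows "int u - int x = int v - int y"
proof -
  have "finite (- dom \<alpha> \<union> {..x + y + u + v})"
    using isometry_cofinite_dom[OF \<alpha>] by simp
  from ex_new_if_finite[OF infinite_UNIV_nat this]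
  obtain n where "n \<notin> - dom \<alpha> \<union> {..x + y + u + v}" ..
  then obtain w where n: "n > x + y + u + v" and w: "\<alpha> n = Some w"
    by auto
  have iso: "\<bar>int (the (\<alpha> i)) - int (the (\<alpha> j))\<bar> = \<bar>int i - int j\<bar>"
    if "i \<in> dom \<alpha>" "j \<in> dom \<alpha>" for i j
    using \<alpha> that unfolding partial_cofinite_isometry_def by blast
  have "\<bar>int w - int u\<bar> = \<bar>int n - int x\<bar>"
    using iso[of n x] w x by auto
  moreover have "\<bar>int w - int v\<bar> = \<bar>int n - int y\<bar>"
    using iso[of n y] w y by auto
  ultimately show ?thesis
    using n by linarith
qed

lemma isometries_agree:
  assumes \<alpha>: "partial_cofinite_isometry \<alpha>" and \<beta>: "partial_cofinite_isometry \<beta>"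
    and i: "i \<in> dom \<alpha> \<inter> dom \<beta>" "\<alpha> i = \<beta> i" and j: "j \<in> dom \<alpha> \<inter> dom \<beta>"
  shows "\<alpha> j = \<beta> j"
proof -
  obtain u v w where h: "\<alpha> i = Some u" "\<beta> i = Some u" "\<alpha> j = Some v" "\<beta> j = Some w"
    using i j by auto
  show ?thesis
    using isometry_shift[OF \<alpha> h(1,3)] isometry_shift[OF \<beta> h(2,4)] h by simp
qed

lemma cofinite_doms_meet:
  fixes \<alpha> \<beta> \<gamma> :: "nat \<rightharpoonup> nat"
  assumes "partial_cofinite_isometry \<alpha>" "partial_cofinite_isometry \<beta>" "partial_cofinite_isometry \<gamma>"
  obtains i where "i \<in> dom \<alpha>" "i \<in> dom \<beta>" "i \<in> dom \<gamma>"
proof -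
  have "finite (- dom \<alpha> \<union> - dom \<beta> \<union> - dom \<gamma>)"
    using assms by (simp add: isometry_cofinite_dom)
  from ex_new_if_finite[OF infinite_UNIV_nat this]
  obtain i where "i \<notin> - dom \<alpha> \<union> - dom \<beta> \<union> - dom \<gamma>" ..
  then show ?thesis
    using that by blast
qed

text \<open>
  If \<open>x\<close> is sent to \<open>z\<close>, idempotence sends \<open>z\<close> to \<open>z\<close> as well, and isometries are injective.
\<close>
lemma idempotent_isometry_fixes:
  assumes e: "partial_cofinite_isometry e" and idem: "e \<circ>\<^sub>m e = e" and x: "x \<in> dom e"
  shows "e x = Some x"
proof -
  obtain z where z: "e x = Some z"
    using x by auto
  have "(e \<circ>\<^sub>m e) x = e z"
    using z by simp
  then have "e z = Some z"
    using idem z by simp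
  then show ?thesis
    using partial_cofinite_isometry_inj[OF e z] z by simp
qed

lemma partial_identity_isometry:
  assumes "A \<subseteq> pos_nats" "finite (pos_nats - A)"
  shows "partial_cofinite_isometry (Some |` A)"
proof -
  have "dom (Some |` A) = A" "ran (Some |` A) = A"
    by (auto simp: dom_def ran_def restrict_map_def)
  then show ?thesis
    using assms by (simp add: partial_cofinite_isometry_def)
qed

lemma congruent_iff:
  "(\<alpha>, \<beta>) \<in> least_group_congruence IN_inf \<longleftrightarrow>
     partial_cofinite_isometry \<alpha> \<and> partial_cofinite_isometry \<beta> \<and>
     (\<exists>e. partial_cofinite_isometry e \<and> e \<circ>\<^sub>m e = e \<and> \<alpha> \<circ>\<^sub>m e = \<beta> \<circ>\<^sub>m e)"
  by (auto simp: least_group_congruence_def IN_inf_def)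

lemma congruent_imp_common_value:
  assumes "(\<alpha>, \<beta>) \<in> least_group_congruence IN_inf"
  shows "\<exists>i\<in>dom \<alpha> \<inter> dom \<beta>. \<alpha> i = \<beta> i"
proof -
  obtain e where \<alpha>: "partial_cofinite_isometry \<alpha>" and \<beta>: "partial_cofinite_isometry \<beta>"
    and e: "partial_cofinite_isometry e" "e \<circ>\<^sub>m e = e" and eq: "\<alpha> \<circ>\<^sub>m e = \<beta> \<circ>\<^sub>m e"
    using assms by (auto simp: congruent_iff)
  obtain i where i: "i \<in> dom \<alpha>" "i \<in> dom \<beta>" "i \<in> dom e"
    using cofinite_doms_meet[OF \<alpha> \<beta> e(1)] .
  have "e i = Some i"
    using idempotent_isometry_fixes[OF e i(3)] .
  then have "\<alpha> i = \<beta> i"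
    using fun_cong[OF eq, of i] by simp
  then show ?thesis
    using i by blast
qed

lemma agree_imp_congruent:
  assumes \<alpha>: "partial_cofinite_isometry \<alpha>" and \<beta>: "partial_cofinite_isometry \<beta>"
    and agree: "\<forall>i\<in>dom \<alpha> \<inter> dom \<beta>. \<alpha> i = \<beta> i"
  shows "(\<alpha>, \<beta>) \<in> least_group_congruence IN_inf"
proof -
  define A where "A = dom \<alpha> \<inter> dom \<beta>"
  have "A \<subseteq> pos_nats" "finite (pos_nats - A)"
    using \<alpha> \<beta> unfolding A_def partial_cofinite_isometry_def Diff_Int by blast+
  then have "partial_cofinite_isometry (Some |` A)"
    by (rule partial_identity_isometry)
  moreover have "(Some |` A) \<circ>\<^sub>m (Some |` A) = Some |` A"
    by (auto simp: fun_eq_iff map_comp_def restrict_map_def)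
  moreover have "\<alpha> \<circ>\<^sub>m (Some |` A) = \<beta> \<circ>\<^sub>m (Some |` A)"
    using agree by (auto simp: A_def fun_eq_iff map_comp_def restrict_map_def)
  ultimately show ?thesis
    using \<alpha> \<beta> unfolding congruent_iff by blast
qed

theorem mainTheorem4:
  fixes \<alpha> \<beta> :: "nat \<rightharpoonup> nat"
  assumes "\<alpha> \<in> carrier IN_inf" and "\<beta> \<in> carrier IN_inf"
  shows "((\<alpha>, \<beta>) \<in> least_group_congruence IN_inf \<longleftrightarrow>
            (\<exists>i\<in>dom \<alpha> \<inter> dom \<beta>. \<alpha> i = \<beta> i)) \<and>
         ((\<exists>i\<in>dom \<alpha> \<inter> dom \<beta>. \<alpha> i = \<beta> i) \<longleftrightarrow>
            (\<forall>i\<in>dom \<alpha> \<inter> dom \<beta>. \<alpha> i = \<beta> i))"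
proof -
  have \<alpha>: "partial_cofinite_isometry \<alpha>" and \<beta>: "partial_cofinite_isometry \<beta>"
    using assms by (simp_all add: IN_inf_def)
  obtain k where "k \<in> dom \<alpha> \<inter> dom \<beta>"
    using cofinite_doms_meet[OF \<alpha> \<beta> \<beta>] by blast
  then have iff: "(\<exists>i\<in>dom \<alpha> \<inter> dom \<beta>. \<alpha> i = \<beta> i) \<longleftrightarrow> (\<forall>i\<in>dom \<alpha> \<inter> dom \<beta>. \<alpha> i = \<beta> i)"
    using isometries_agree[OF \<alpha> \<beta>] by blast
  show ?thesis
    using iff congruent_imp_common_value agree_imp_congruent[OF \<alpha> \<beta>] by blast
qed

end
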